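(* Let $m,n\ge 1$ be integers, let $N=m+n$, and let $V$ be an $m$-codimensional linear subspace of the real space $\ell_\infty^N$. Let $(f^1,\ldots,f^m)$ be a basis of $V^\perp$ and let $F\in\mathbb{R}^{N\times m}$ be the matrix with columns $f^1,\ldots,f^m$. For $S\subseteq\{1,\ldots,N\}$ with $|S|=m$ and $\det(F_S)\neq 0$, let $h(S)^k\in\mathbb{R}^N$, $k\in S$, be the vectors defined in the context. Then the following statements are equivalent: (i) there exists an index set $S\subseteq\{1,\ldots,N\}$ of size $m$, with $\det(F_S)\neq 0$, such that $\|h(S)^k\|_1\le 2$ for all $k\in S$; (ii) $V$ is isometrically isomorphic to $\ell_\infty^n$, i.e., $d(V,\ell_\infty^n)=1$; (iii) the projection constant of $V$ equals one, i.e., $\lambda(V)=1$.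
   Context: All spaces are real. $\ell_\infty^N$ is $\mathbb{R}^N$ with the norm $\|x\|_\infty=\max_i|x_i|$, and $\|x\|_1=\sum_{i=1}^N|x_i|$. A subspace $V$ of $\ell_\infty^N$ carries the norm $\|\cdot\|_\infty$. $V^\perp$ is the orthogonal complement of $V$ in $\mathbb{R}^N$ for the standard inner product, so that $V=\{x\in\mathbb{R}^N:\langle f^1,x\rangle=\cdots=\langle f^m,x\rangle=0\}$. For $S\subseteq\{1,\ldots,N\}$ with $|S|=m$, $F_S\in\mathbb{R}^{m\times m}$ denotes the row-submatrix of $F$ with rows indexed by $S$. When $\det(F_S)\ne 0$, for $k\in S$ the vector $h(S)^k\in\mathbb{R}^N$ has entries $$h(S)^k_i=\frac{\det(F_S[\mathrm{row}_k\leftarrow\mathrm{row}_i])}{\det(F_S)},\qquad i=1,\ldots,N,$$ where $F_S[\mathrm{row}_k\leftarrow\mathrm{row}_i]$ is the matrix obtained from $F_S$ by replacing its row indexed by $k$ with the $i$th row of $F$. (The vectors $h(S)^k$ do not depend on the choice of the basis $(f^1,\ldots,f^m)$ of $V^\perp$.) The Banach--Mazur distance between isomorphic finite-dimensional normed spaces $V,W$ is $d(V,W)=\min\{\|T\|\,\|T^{-1}\|: T \text{ is a linear isomorphism from } V \text{ to } W\}$, with operator norms. The projection constant of a subspace $V$ of $\ell_\infty^N$ is $\lambda(V)=\min\{\|P\|: P \text{ is a linear projection from } \ell_\infty^N \text{ onto } V\}$, where $\|P\|$ is the operator norm of $P:\ell_\infty^N\to\ell_\infty^N$. *)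

theory Defs
  imports "HOL-Analysis.Analysis"
begin

text \<open>
  The space \<open>\<ell>\<^sub>\<infinity>\<^sup>N\<close> is the type \<open>real ^ 'N\<close> with the library norm \<open>infnorm\<close> (see
  \<open>infnorm_cart\<close>); the type class norm of \<open>real ^ 'N\<close> is the Euclidean one and is not used.
\<close>

text \<open>
  Only the values of \<open>T\<close> on \<open>V\<close> matter, so this is the operator norm of \<open>T\<close> as an operator
  on the subspace \<open>V\<close> with the norm inherited from \<open>\<ell>\<^sub>\<infinity>\<^sup>N\<close>.
\<close>
definition linf_opnorm :: "(real ^ 'a) set \<Rightarrow> (real ^ 'a \<Rightarrow> real ^ 'b) \<Rightarrow> real" where
  "linf_opnorm V T = (SUP x \<in> {x \<in> V. infnorm x \<le> 1}. infnorm (T x))"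

definition linear_iso_betw ::
    "(real ^ 'a \<Rightarrow> real ^ 'b) \<Rightarrow> (real ^ 'a) set \<Rightarrow> (real ^ 'b) set \<Rightarrow> bool" where
  "linear_iso_betw T V W \<longleftrightarrow>
     (\<forall>x\<in>V. \<forall>y\<in>V. T (x + y) = T x + T y) \<and>
     (\<forall>c. \<forall>x\<in>V. T (c *\<^sub>R x) = c *\<^sub>R T x) \<and>
     bij_betw T V W"

definition isometrically_isomorphic :: "(real ^ 'a) set \<Rightarrow> (real ^ 'b) set \<Rightarrow> bool" where
  "isometrically_isomorphic V W \<longleftrightarrow>
     (\<exists>T. linear_iso_betw T V W \<and> (\<forall>x\<in>V. infnorm (T x) = infnorm x))"

text \<open>
  For subspaces of equal dimension the infimum ranges over a nonempty set and is attained by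
  compactness, so it is the minimum. If the two subspaces are not isomorphic, the value is
  meaningless.
\<close>
definition banach_mazur :: "(real ^ 'a) set \<Rightarrow> (real ^ 'b) set \<Rightarrow> real" where
  "banach_mazur V W =
     Inf {linf_opnorm V T * linf_opnorm W (inv_into V T) |T. linear_iso_betw T V W}"

definition linear_projection_onto :: "(real ^ 'N \<Rightarrow> real ^ 'N) \<Rightarrow> (real ^ 'N) set \<Rightarrow> bool" where
  "linear_projection_onto P V \<longleftrightarrow> linear P \<and> P \<circ> P = P \<and> range P = V"

text \<open>Again the infimum is attained, for every subspace \<open>V\<close>.\<close>
definition projection_constant :: "(real ^ 'N) set \<Rightarrow> real" where
  "projection_constant V = Inf {linf_opnorm UNIV P |P. linear_projection_onto P V}"

text \<open>
  A matrix whose rows are indexed by a subset \<open>S\<close> of \<open>'N\<close> with \<open>CARD('m)\<close> elements is turned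
  into a square matrix over \<open>'m\<close> by an arbitrary but fixed enumeration of \<open>S\<close>. Changing the
  enumeration changes determinants at most by a sign and leaves the vectors \<open>h(S)\<^sup>k\<close>
  unchanged; see the lemmas below.
\<close>
definition row_enum :: "'N set \<Rightarrow> 'm \<Rightarrow> 'N" where
  "row_enum S = (SOME e. bij_betw e UNIV S)"

definition row_submatrix :: "real ^ 'm ^ 'N \<Rightarrow> 'N set \<Rightarrow> real ^ 'm ^ 'm" where
  "row_submatrix F S = (\<chi> a. F $ row_enum S a)"

definition row_submatrix_replace ::
    "real ^ 'm ^ 'N \<Rightarrow> 'N set \<Rightarrow> 'N \<Rightarrow> 'N \<Rightarrow> real ^ 'm ^ 'm" where
  "row_submatrix_replace F S k i =
     (\<chi> a. if row_enum S a = k then F $ i else F $ row_enum S a)"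

definition h_vec :: "real ^ 'm ^ 'N \<Rightarrow> 'N set \<Rightarrow> 'N \<Rightarrow> real ^ 'N" where
  "h_vec F S k = (\<chi> i. det (row_submatrix_replace F S k i) / det (row_submatrix F S))"

lemma bij_betw_row_enum:
  fixes S :: "'N::finite set"
  assumes "card S = CARD('m::finite)"
  shows "bij_betw (row_enum S :: 'm \<Rightarrow> 'N) UNIV S"
proof -
  have "\<exists>e :: 'm \<Rightarrow> 'N. bij_betw e UNIV S"
    using assms by (intro finite_same_card_bij) auto
  then show ?thesis
    unfolding row_enum_def by (rule someI_ex)
qed

lemma row_submatrix_enum_independent:
  fixes F :: "real ^ 'm ^ 'N" and e :: "'m \<Rightarrow> 'N"
  assumes e: "bij_betw e UNIV S"
  shows "\<bar>det (row_submatrix F S)\<bar> = \<bar>det (\<chi> a. F $ e a :: real ^ 'm ^ 'm)\<bar>"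
    and "h_vec F S k $ i =
           det (\<chi> a. if e a = k then F $ i else F $ e a :: real ^ 'm ^ 'm) /
           det (\<chi> a. F $ e a :: real ^ 'm ^ 'm)"
proof -
  have card: "card S = CARD('m)"
    using bij_betw_same_card[OF e] by simp
  define r where "r = (row_enum S :: 'm \<Rightarrow> 'N)"
  have r: "bij_betw r UNIV S"
    unfolding r_def using card by (rule bij_betw_row_enum)
  define p where "p = inv_into UNIV e \<circ> r"
  have p: "p permutes UNIV"
    unfolding p_def permutes_univ
    by (metis UNIV_I bij_betw_inv_into bij_betw_trans bij_pointE e r)
  have ep: "e (p a) = r a" for a
    using e r unfolding p_def
    by (metis UNIV_I bij_betwE bij_betw_inv_into_right comp_apply)
  have perm: "det (\<chi> a. G (r a) :: real ^ 'm ^ 'm) =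
      of_int (sign p) * det (\<chi> a. G (e a) :: real ^ 'm ^ 'm)" for G :: "'N \<Rightarrow> real ^ 'm"
    using det_permute_rows[OF p, of "\<chi> a. G (e a)"] by (simp add: ep)
  have d: "det (row_submatrix F S) = of_int (sign p) * det (\<chi> a. F $ e a :: real ^ 'm ^ 'm)"
    unfolding row_submatrix_def r_def[symmetric] by (rule perm)
  have sgn: "\<bar>real_of_int (sign p)\<bar> = 1"
    by (simp add: sign_def)
  show "\<bar>det (row_submatrix F S)\<bar> = \<bar>det (\<chi> a. F $ e a :: real ^ 'm ^ 'm)\<bar>"
    by (simp add: d abs_mult sgn)
  have "det (row_submatrix_replace F S k i) =
      of_int (sign p) * det (\<chi> a. if e a = k then F $ i else F $ e a :: real ^ 'm ^ 'm)"
    unfolding row_submatrix_replace_def r_def[symmetric]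
    by (rule perm[of "\<lambda>j. if j = k then F $ i else F $ j"])
  then show "h_vec F S k $ i =
           det (\<chi> a. if e a = k then F $ i else F $ e a :: real ^ 'm ^ 'm) /
           det (\<chi> a. F $ e a :: real ^ 'm ^ 'm)"
    using sgn by (auto simp: h_vec_def d)
qed

end

theory Submission
  imports Defs
begin

text \<open>
  Write \<open>n = dim V\<close>. All the conditions turn out to say that \<open>V\<close> has \<open>n\<close> coordinates that are
  norming: a set \<open>I\<close> of \<open>n\<close> indices such that every \<open>x \<in> V\<close> attains its maximum norm on \<open>I\<close>. A
  norming set determines the vectors of \<open>V\<close>, so it has at least \<open>n\<close> elements, and if it has
  exactly \<open>n\<close>, then the coordinates in it can be prescribed arbitrarily
  (\<open>norming_interpolation\<close>).

  Condition (i) is this property for \<open>I = - S\<close>. By Cramer's rule \<open>h(S)\<^sup>k\<close> is the vector of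
  \<open>V\<^sup>\<bottom>\<close> that expresses \<open>x\<^sub>k\<close>, for \<open>x \<in> V\<close> and \<open>k \<in> S\<close>, through the coordinates of \<open>x\<close> outside
  \<open>S\<close>. Its entry at \<open>k\<close> is 1, so the bound 2 on its norm says that the coefficients of this
  expression have absolute sum at most 1, which is the same as
  \<open>\<bar>x\<^sub>k\<bar> \<le> max {\<bar>x\<^sub>i\<bar> | i \<notin> S}\<close>.

  Restriction to \<open>I\<close> is then an isometry onto \<open>\<ell>\<^sub>\<infinity>\<^sup>n\<close>, and filling in the vector of \<open>V\<close> with
  given coordinates on \<open>I\<close> is a projection of norm 1. The converses carry the work.

  For the Banach-Mazur distance (\<open>norming_of_banach_mazur_1\<close>): if \<open>T\<close> maps \<open>V\<close> onto
  \<open>\<ell>\<^sub>\<infinity>\<^sup>n\<close> with distortion close to 1, then each of the \<open>n\<close> columns of the matrix of \<open>T\<^sup>-\<^sup>1\<close> has an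
  entry that nearly exhausts the absolute sum of its row, and the rows found in this way
  form an almost norming set of at most \<open>n\<close> indices. Since there are only finitely many
  sets of indices, one of them is almost norming with all constants below 1, hence norming.

  For the projection constant (\<open>norming_of_projection\<close>): compactness yields a projection \<open>P\<close>
  of norm 1, so the rows of its matrix have absolute sum at most 1. Take a minimal norming set
  \<open>I\<close>. For \<open>i \<in> I\<close> there is an \<open>x \<in> V\<close> whose coordinate \<open>i\<close> strictly dominates the other
  coordinates in \<open>I\<close>. The equation \<open>x = P x\<close> leaves no slack in row \<open>i\<close>, for \<open>x\<close> and for all
  nearby vectors of \<open>V\<close>, so that every coordinate in the support of row \<open>i\<close> agrees on \<open>V\<close> with
  the coordinate \<open>i\<close> up to sign. Therefore different rows in \<open>I\<close> have disjoint supports, and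
  \<open>P\<close> takes arbitrary values on \<open>I\<close>, which forces \<open>I\<close> to have only \<open>n\<close> elements.
\<close>

section \<open>The maximum norm on coordinate spaces\<close>

lemma infnorm_attained_cart:
  fixes x :: "real ^ 'a::finite"
  obtains i where "infnorm x = \<bar>x $ i\<bar>"
proof -
  have eq: "{\<bar>x $ i\<bar> |i. i \<in> UNIV} = range (\<lambda>i. \<bar>x $ i\<bar>)" by auto
  have "infnorm x = Max (range (\<lambda>i. \<bar>x $ i\<bar>))"
    unfolding infnorm_cart eq by (rule cSup_eq_Max) auto
  also have "\<dots> \<in> range (\<lambda>i. \<bar>x $ i\<bar>)" by (rule Max_in) auto
  finally show ?thesis using that by auto
qed

lemma infnorm_le_iff_cart:
  fixes x :: "real ^ 'a::finite"
  shows "infnorm x \<le> c \<longleftrightarrow> (\<forall>i. \<bar>x $ i\<bar> \<le> c)"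
proof
  assume "infnorm x \<le> c" then show "\<forall>i. \<bar>x $ i\<bar> \<le> c"
    using component_le_infnorm_cart order_trans by blast
next
  assume "\<forall>i. \<bar>x $ i\<bar> \<le> c" then show "infnorm x \<le> c"
    by (metis infnorm_attained_cart)
qed

lemma linear_component_sum:
  fixes U :: "real ^ 'a::finite \<Rightarrow> real ^ 'b::finite"
  assumes "linear U"
  shows "U y $ i = (\<Sum>j\<in>UNIV. U (axis j 1) $ i * y $ j)"
proof -
  have "U y = matrix U *v y" using assms by (simp add: matrix_works)
  then show ?thesis by (simp add: matrix_vector_mult_def matrix_def)
qed

text \<open>The vector of signs of the row attains the row sum.\<close>
lemma abs_row_sum_le:
  fixes U :: "real ^ 'a::finite \<Rightarrow> real ^ 'b::finite"
  assumes U: "linear U" and bound: "\<And>y. infnorm (U y) \<le> c * infnorm y"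
  shows "(\<Sum>j\<in>UNIV. \<bar>U (axis j 1) $ i\<bar>) \<le> c"
proof -
  define y :: "real ^ 'a" where "y = (\<chi> j. if U (axis j 1) $ i < 0 then -1 else 1)"
  have y: "infnorm y = 1"
    by (rule infnorm_attained_cart[of y]) (auto simp: y_def)
  have "(\<Sum>j\<in>UNIV. \<bar>U (axis j 1) $ i\<bar>) = U y $ i"
    unfolding linear_component_sum[OF U, of y] by (intro sum.cong) (auto simp: y_def)
  also have "\<dots> \<le> infnorm (U y)"
    using component_le_infnorm_cart[of "U y" i] by linarith
  finally show ?thesis using bound[of y] y by simp
qed

section \<open>Operator norms and projections\<close>

lemma ex_linear_projection_onto:
  fixes V :: "(real ^ 'N::finite) set"
  assumes "subspace V"
  shows "\<exists>P. linear_projection_onto P V"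
proof -
  obtain P where P: "range P \<subseteq> V" "linear P" "\<forall>v\<in>V. P v = v"
    using linear_exists_left_inverse_on[OF linear_id assms] by auto
  then have "P \<circ> P = P" "range P = V" by (auto simp: fun_eq_iff) (metis rangeI)
  with P show ?thesis unfolding linear_projection_onto_def by blast
qed

lemma projection_fixes_range:
  assumes "linear_projection_onto P V" "x \<in> V"
  shows "P x = x"
  using assms unfolding linear_projection_onto_def by (auto simp: fun_eq_iff)

lemma linear_extension_from_subspace:
  fixes V :: "(real ^ 'a::finite) set" and T :: "real ^ 'a \<Rightarrow> real ^ 'b::finite"
  assumes V: "subspace V"
    and add: "\<And>x y. x \<in> V \<Longrightarrow> y \<in> V \<Longrightarrow> T (x + y) = T x + T y"
    and scale: "\<And>c x. x \<in> V \<Longrightarrow> T (c *\<^sub>R x) = c *\<^sub>R T x"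
  obtains g where "linear g" "\<And>x. x \<in> V \<Longrightarrow> g x = T x"
proof -
  obtain P where P: "linear_projection_onto P V"
    using ex_linear_projection_onto[OF V] by blast
  then have lin: "linear P" and inV: "P x \<in> V" for x
    unfolding linear_projection_onto_def by auto
  have "linear (T \<circ> P)"
    by (rule linearI) (auto simp: linear_add[OF lin] linear_scale[OF lin] add scale inV)
  with projection_fixes_range[OF P] show ?thesis by (intro that[of "T \<circ> P"]) auto
qed

lemma linear_infnorm_bound:
  fixes g :: "real ^ 'a::finite \<Rightarrow> real ^ 'b::finite"
  assumes "linear g"
  obtains B where "B \<ge> 0" "\<And>x. infnorm (g x) \<le> B * infnorm x"
proof -
  obtain B where B: "B > 0" "\<And>x. norm (g x) \<le> B * norm x"
    using linear_bounded_pos[OF assms] by blast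
  show ?thesis
  proof (rule that[of "B * sqrt DIM(real ^ 'a)"])
    fix x
    have "infnorm (g x) \<le> B * norm x" using infnorm_le_norm B(2) order_trans by blast
    also have "\<dots> \<le> B * (sqrt DIM(real ^ 'a) * infnorm x)"
      using B(1) norm_le_infnorm[of x] by (intro mult_left_mono) auto
    finally show "infnorm (g x) \<le> B * sqrt DIM(real ^ 'a) * infnorm x" by simp
  qed (use B(1) in auto)
qed

lemma infnorm_le_linf_opnorm:
  fixes V :: "(real ^ 'a::finite) set"
  assumes V: "subspace V" and g: "linear g" "\<And>x. x \<in> V \<Longrightarrow> g x = T x" and x: "x \<in> V"
  shows "infnorm (T x) \<le> linf_opnorm V T * infnorm x"
proof (cases "x = 0")
  case True
  then show ?thesis using g x by (metis infnorm_0 linear_0 mult_zero_right order_refl)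
next
  case False
  define c where "c = infnorm x"
  have c: "c > 0" using False by (simp add: c_def infnorm_pos_lt)
  obtain B where B: "B \<ge> 0" "\<And>x. infnorm (g x) \<le> B * infnorm x"
    using linear_infnorm_bound[OF g(1)] by blast
  have bdd: "bdd_above ((\<lambda>x. infnorm (T x)) ` {x \<in> V. infnorm x \<le> 1})"
  proof (rule bdd_aboveI2)
    fix y assume "y \<in> {x \<in> V. infnorm x \<le> 1}"
    then have "infnorm (T y) \<le> B * infnorm y" "B * infnorm y \<le> B * 1"
      using B g(2)[of y] by (metis mem_Collect_eq, intro mult_left_mono) auto
    then show "infnorm (T y) \<le> B" by linarith
  qed
  define y where "y = (1 / c) *\<^sub>R x"
  have y: "y \<in> V" "infnorm y \<le> 1"
    using x V c by (auto simp: y_def infnorm_mul subspace_scale c_def)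
  have "infnorm (T y) \<le> linf_opnorm V T"
    unfolding linf_opnorm_def by (rule cSUP_upper) (use y bdd in auto)
  moreover have "T y = (1 / c) *\<^sub>R T x"
    using g y x by (metis linear_scale y_def)
  ultimately show ?thesis
    using c by (simp add: infnorm_mul c_def[symmetric] field_simps)
qed

lemma linf_opnorm_le:
  assumes V: "subspace V" and "c \<ge> 0" and bound: "\<And>x. x \<in> V \<Longrightarrow> infnorm (T x) \<le> c * infnorm x"
  shows "linf_opnorm V T \<le> c"
  unfolding linf_opnorm_def
proof (rule cSUP_least)
  show "{x \<in> V. infnorm x \<le> 1} \<noteq> {}"
    using subspace_0[OF V] by (auto simp: infnorm_0 intro!: exI[of _ 0])
  fix x assume "x \<in> {x \<in> V. infnorm x \<le> 1}"
  then have "infnorm (T x) \<le> c * infnorm x" "c * infnorm x \<le> c * 1"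
    using assms by (auto intro!: mult_left_mono simp del: mult_1_right)
  then show "infnorm (T x) \<le> c" by linarith
qed

section \<open>Norming sets of coordinates\<close>

text \<open>Equivalently, the maximum norm of each vector of \<open>V\<close> is already attained on \<open>I\<close>.\<close>
definition norming :: "'N set \<Rightarrow> (real ^ 'N) set \<Rightarrow> bool" where
  "norming I V \<longleftrightarrow> (\<forall>x\<in>V. \<forall>i. \<exists>j\<in>I. \<bar>x $ i\<bar> \<le> \<bar>x $ j\<bar>)"

definition truncate :: "'N set \<Rightarrow> real ^ 'N \<Rightarrow> real ^ 'N" where
  "truncate I x = (\<chi> i. if i \<in> I then x $ i else 0)"

lemma linear_truncate: "linear (truncate I :: real ^ 'N::finite \<Rightarrow> real ^ 'N)"
  by (rule linearI) (auto simp: truncate_def vec_eq_iff)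

lemma norming_bound:
  assumes "norming I V" "x \<in> V" "\<And>j. j \<in> I \<Longrightarrow> \<bar>x $ j\<bar> \<le> c"
  shows "\<bar>x $ i\<bar> \<le> c"
  using assms unfolding norming_def by (meson order_trans)

lemma truncate_image_supported:
  "truncate I ` V \<subseteq> {x :: real ^ 'N::finite. \<forall>i. i \<notin> I \<longrightarrow> x $ i = 0}"
  by (auto simp: truncate_def)

lemma dim_supported:
  "dim {x :: real ^ 'N::finite. \<forall>i. i \<notin> I \<longrightarrow> x $ i = 0} = card I"
  using dim_substandard_cart[of I, where ?'a = real] by (simp add: dim_vec_eq)

lemma norming_inj_on_truncate:
  fixes V :: "(real ^ 'N::finite) set"
  assumes V: "subspace V" and I: "norming I V"
  shows "inj_on (truncate I) V"
proof -
  have "x = 0" if x: "x \<in> V" and 0: "truncate I x = 0" for x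
  proof -
    have "\<bar>x $ j\<bar> \<le> 0" if "j \<in> I" for j
      using 0 that by (auto simp: truncate_def vec_eq_iff split: if_splits)
    then show ?thesis using norming_bound[OF I x, of 0] by (simp add: vec_eq_iff)
  qed
  then show ?thesis
    using linear_inj_on_iff_eq_0[OF linear_truncate V] by blast
qed

lemma norming_dim_truncate:
  fixes V :: "(real ^ 'N::finite) set"
  assumes V: "subspace V" and I: "norming I V"
  shows "dim (truncate I ` V) = dim V"
proof -
  have "span V = V" using V by (rule span_eq_iff[THEN iffD2])
  then show ?thesis
    using dim_image_eq[OF linear_truncate, of I V] norming_inj_on_truncate[OF V I] by metis
qed

lemma norming_dim_le_card:
  fixes V :: "(real ^ 'N::finite) set"
  assumes V: "subspace V" and I: "norming I V"
  shows "dim V \<le> card I"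
proof -
  have "dim V = dim (truncate I ` V)" using norming_dim_truncate[OF V I] by simp
  also have "\<dots> \<le> card I"
    using dim_subset[OF truncate_image_supported[of I V]] by (simp add: dim_supported)
  finally show ?thesis .
qed

text \<open>
  A norming set determines the vectors of \<open>V\<close>, so if it has the least possible size, the
  coordinates in it are a system of linear coordinates on \<open>V\<close>.
\<close>
lemma norming_interpolation:
  fixes V :: "(real ^ 'N::finite) set"
  assumes V: "subspace V" and I: "norming I V" and card: "card I = dim V"
  obtains x where "x \<in> V" "\<And>i. i \<in> I \<Longrightarrow> x $ i = t i"
proof -
  let ?W = "{x :: real ^ 'N. \<forall>i. i \<notin> I \<longrightarrow> x $ i = 0}"
  have W: "subspace ?W" by (auto simp: subspace_def)
  have "truncate I ` V = ?W"
    by (rule subspace_dim_equal[OF linear_subspace_image[OF linear_truncate V] W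
          truncate_image_supported]) (simp add: norming_dim_truncate[OF V I] dim_supported card)
  moreover have "(\<chi> i. if i \<in> I then t i else 0) \<in> ?W" by auto
  ultimately obtain x where "x \<in> V" "(\<chi> i. if i \<in> I then t i else 0) = truncate I x"
    by (metis (no_types, lifting) imageE)
  then show ?thesis
    by (intro that[of x]) (auto simp: truncate_def vec_eq_iff split: if_splits; metis)+
qed

section \<open>Norming sets and the vectors of minors\<close>

lemma h_vec_diagonal:
  fixes F :: "real ^ 'm::finite ^ 'N::finite"
  assumes card: "card S = CARD('m)" and det: "det (row_submatrix F S) \<noteq> 0"
    and k: "k \<in> S" and l: "l \<in> S"
  shows "h_vec F S k $ l = (if l = k then 1 else 0)"
proof -
  define e where "e = (row_enum S :: 'm \<Rightarrow> 'N)"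
  have e: "bij_betw e UNIV S" unfolding e_def by (rule bij_betw_row_enum[OF card])
  obtain a b where a: "e a = k" and b: "e b = l"
    using e k l unfolding bij_betw_def by blast
  show ?thesis
  proof (cases "l = k")
    case True
    then have "row_submatrix_replace F S k l = row_submatrix F S"
      by (auto simp: row_submatrix_replace_def row_submatrix_def vec_eq_iff)
    then show ?thesis using det True by (simp add: h_vec_def)
  next
    case False
    have "det (row_submatrix_replace F S k l) = 0"
    proof (rule det_identical_rows[of a b])
      show "a \<noteq> b" using a b False by auto
      show "row a (row_submatrix_replace F S k l) = row b (row_submatrix_replace F S k l)"
        using a b False by (simp add: row_def row_submatrix_replace_def e_def vec_eq_iff)
    qed
    then show ?thesis using False by (simp add: h_vec_def)
  qed
qed

text \<open>By Cramer's rule the vectors \<open>h(S)\<^sup>k\<close> are the coordinates of the rows of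
  \<open>F\<close> in the basis given by the rows of \<open>F\<^sub>S\<close>. Hence they are linear combinations of the
  columns of \<open>F\<close>, and orthogonal to whatever the columns are orthogonal to.\<close>
lemma row_eq_sum_h_vec:
  fixes F :: "real ^ 'm::finite ^ 'N::finite"
  assumes card: "card S = CARD('m)" and det: "det (row_submatrix F S) \<noteq> 0"
  shows "F $ i = (\<Sum>a\<in>UNIV. h_vec F S (row_enum S a) $ i *s row a (row_submatrix F S))"
proof -
  let ?G = "row_submatrix F S"
  have inj: "inj (row_enum S :: 'm \<Rightarrow> 'N)"
    using bij_betw_row_enum[OF card] by (simp add: bij_betw_def)
  have "invertible (transpose ?G)"
    using det by (simp add: invertible_det_nz)
  then obtain B where "transpose ?G ** B = mat 1" unfolding invertible_def by blast
  then have "transpose ?G *v (B *v (F $ i)) = F $ i"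
    by (simp add: matrix_vector_mul_assoc)
  then obtain c where "transpose ?G *v c = F $ i" by blast
  then have c: "(\<Sum>a\<in>UNIV. c $ a *s row a ?G) = F $ i"
    by (simp add: matrix_mult_sum column_def transpose_def row_def)
  have "h_vec F S (row_enum S a) $ i = c $ a" for a
  proof -
    have "row_submatrix_replace F S (row_enum S a) i =
        (\<chi> b. if b = a then (\<Sum>b\<in>UNIV. c $ b *s row b ?G) else row b ?G)"
      unfolding c by (auto simp: row_submatrix_replace_def row_submatrix_def row_def vec_eq_iff
          inj_eq[OF inj])
    then show ?thesis
      using cramer_lemma_transpose[of a c ?G] det by (simp add: h_vec_def)
  qed
  then show ?thesis using c by simp
qed

lemma h_vec_orthogonal:
  fixes F :: "real ^ 'm::finite ^ 'N::finite"
  assumes card: "card S = CARD('m)" and det: "det (row_submatrix F S) \<noteq> 0"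
    and x: "transpose F *v x = 0" and k: "k \<in> S"
  shows "(\<Sum>i\<in>UNIV. h_vec F S k $ i * x $ i) = 0"
proof -
  let ?G = "row_submatrix F S"
  define w :: "real ^ 'm" where "w = (\<chi> a. \<Sum>i\<in>UNIV. h_vec F S (row_enum S a) $ i * x $ i)"
  have "transpose ?G *v w = transpose F *v x"
  proof (rule vec_eq_iff[THEN iffD2], rule allI)
    fix b
    have "(transpose F *v x) $ b = (\<Sum>i\<in>UNIV. F $ i $ b * x $ i)"
      by (simp add: matrix_vector_mult_def transpose_def)
    also have "\<dots> = (\<Sum>i\<in>UNIV. \<Sum>a\<in>UNIV. h_vec F S (row_enum S a) $ i * ?G $ a $ b * x $ i)"
      by (subst row_eq_sum_h_vec[OF card det]) (simp add: row_def sum_distrib_right)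
    also have "\<dots> = (\<Sum>a\<in>UNIV. \<Sum>i\<in>UNIV. h_vec F S (row_enum S a) $ i * ?G $ a $ b * x $ i)"
      by (rule sum.swap)
    also have "\<dots> = (transpose ?G *v w) $ b"
      by (simp add: matrix_vector_mult_def transpose_def w_def sum_distrib_left mult_ac)
    finally show "(transpose ?G *v w) $ b = (transpose F *v x) $ b" by simp
  qed
  moreover have "invertible (transpose ?G)" using det by (simp add: invertible_det_nz)
  ultimately have "w = 0"
    using x by (metis invertible_def matrix_left_invertible_ker)
  moreover have "k \<in> range (row_enum S :: 'm \<Rightarrow> 'N)"
    using bij_betw_row_enum[OF card] k by (simp add: bij_betw_def)
  ultimately show ?thesis by (auto simp: w_def vec_eq_iff)
qed

lemma h_vec_solves_coordinate:
  fixes F :: "real ^ 'm::finite ^ 'N::finite"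
  assumes card: "card S = CARD('m)" and det: "det (row_submatrix F S) \<noteq> 0"
    and x: "transpose F *v x = 0" and k: "k \<in> S"
  shows "x $ k = - (\<Sum>i\<in>-S. h_vec F S k $ i * x $ i)"
proof -
  have "(\<Sum>i\<in>UNIV. h_vec F S k $ i * x $ i) =
      (\<Sum>i\<in>S. h_vec F S k $ i * x $ i) + (\<Sum>i\<in>-S. h_vec F S k $ i * x $ i)"
    by (subst sum.union_disjoint[symmetric]) auto
  moreover have "(\<Sum>i\<in>S. h_vec F S k $ i * x $ i) = (\<Sum>i\<in>S. if i = k then x $ i else 0)"
    using h_vec_diagonal[OF card det k] by (intro sum.cong) auto
  moreover have "\<dots> = x $ k" using k by simp
  ultimately show ?thesis using h_vec_orthogonal[OF card det x k] by linarith
qed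

lemma h_vec_l1_norm:
  fixes F :: "real ^ 'm::finite ^ 'N::finite"
  assumes card: "card S = CARD('m)" and det: "det (row_submatrix F S) \<noteq> 0" and k: "k \<in> S"
  shows "(\<Sum>i\<in>UNIV. \<bar>h_vec F S k $ i\<bar>) = 1 + (\<Sum>i\<in>-S. \<bar>h_vec F S k $ i\<bar>)"
proof -
  have "(\<Sum>i\<in>UNIV. \<bar>h_vec F S k $ i\<bar>) =
      (\<Sum>i\<in>S. \<bar>h_vec F S k $ i\<bar>) + (\<Sum>i\<in>-S. \<bar>h_vec F S k $ i\<bar>)"
    by (subst sum.union_disjoint[symmetric]) auto
  moreover have "(\<Sum>i\<in>S. \<bar>h_vec F S k $ i\<bar>) = (\<Sum>i\<in>S. if i = k then 1 else 0)"
    using h_vec_diagonal[OF card det k] by (intro sum.cong) auto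
  ultimately show ?thesis using k by simp
qed

lemma norming_of_h_vec_bound:
  fixes F :: "real ^ 'm::finite ^ 'N::finite"
  assumes card: "card S = CARD('m)" and det: "det (row_submatrix F S) \<noteq> 0"
    and V: "\<And>x. x \<in> V \<Longrightarrow> transpose F *v x = 0" and S: "S \<noteq> UNIV"
    and bound: "\<And>k. k \<in> S \<Longrightarrow> (\<Sum>i\<in>UNIV. \<bar>h_vec F S k $ i\<bar>) \<le> 2"
  shows "norming (- S) V"
  unfolding norming_def
proof (intro ballI allI)
  fix x i assume x: "x \<in> V"
  define M where "M = Max ((\<lambda>j. \<bar>x $ j\<bar>) ` (- S))"
  have "M \<in> (\<lambda>j. \<bar>x $ j\<bar>) ` (- S)"
    unfolding M_def by (rule Max_in) (use S in auto)
  then obtain j where j: "j \<in> - S" "\<bar>x $ j\<bar> = M" by auto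
  have M: "\<bar>x $ l\<bar> \<le> M" if "l \<in> - S" for l
    unfolding M_def using that by (intro Max_ge) auto
  have "\<bar>x $ i\<bar> \<le> M"
  proof (cases "i \<in> S")
    case True
    have "\<bar>x $ i\<bar> \<le> (\<Sum>l\<in>-S. \<bar>h_vec F S i $ l * x $ l\<bar>)"
      using h_vec_solves_coordinate[OF card det V[OF x] True] sum_abs[of _ "- S"] by simp
    also have "\<dots> \<le> (\<Sum>l\<in>-S. \<bar>h_vec F S i $ l\<bar> * M)"
      by (intro sum_mono) (simp add: abs_mult mult_left_mono M)
    also have "\<dots> = (\<Sum>l\<in>-S. \<bar>h_vec F S i $ l\<bar>) * M" by (simp add: sum_distrib_right)
    also have "\<dots> \<le> 1 * M"
      using h_vec_l1_norm[OF card det True] bound[OF True] j(2) by (intro mult_right_mono) auto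
    finally show ?thesis by simp
  qed (simp add: M)
  then show "\<exists>j\<in>-S. \<bar>x $ i\<bar> \<le> \<bar>x $ j\<bar>" using j by auto
qed

text \<open>A vector of \<open>V\<^sup>\<bottom>\<close> that is supported on a norming set of size \<open>dim V\<close> vanishes, since
  \<open>V\<close> contains a vector that agrees with it there. This makes \<open>F\<^sub>S\<close> invertible for the
  complement \<open>S\<close>.\<close>
lemma det_row_submatrix_nonzero:
  fixes F :: "real ^ 'm::finite ^ 'N::finite"
  assumes V: "subspace V" "\<And>x. x \<in> V \<Longrightarrow> transpose F *v x = 0"
    and inj: "\<And>w. F *v w = 0 \<Longrightarrow> w = 0"
    and I: "norming I V" "card I = dim V" and card: "card (- I) = CARD('m)"
  shows "det (row_submatrix F (- I)) \<noteq> 0"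
proof -
  let ?G = "row_submatrix F (- I)"
  have "w = 0" if w: "?G *v w = 0" for w
  proof -
    define v where "v = F *v w"
    have v0: "v $ i = 0" if "i \<notin> I" for i
    proof -
      have "i \<in> range (row_enum (- I) :: 'm \<Rightarrow> 'N)"
        using bij_betw_row_enum[OF card] \<open>i \<notin> I\<close> by (simp add: bij_betw_def)
      then obtain a where "row_enum (- I) (a :: 'm) = i" by blast
      then have "v $ i = (?G *v w) $ a"
        by (auto simp: v_def matrix_vector_mult_def row_submatrix_def)
      then show ?thesis using w by simp
    qed
    obtain x where x: "x \<in> V" "\<And>i. i \<in> I \<Longrightarrow> x $ i = v $ i"
      using norming_interpolation[OF V(1) I, of "\<lambda>i. v $ i"] by blast
    have "v \<bullet> v = v \<bullet> x"
      unfolding inner_vec_def using x(2) v0 by (intro sum.cong) (auto, metis)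
    also have "\<dots> = w \<bullet> (transpose F *v x)"
      by (metis v_def dot_lmul_matrix inner_commute transpose_matrix_vector)
    finally have "v = 0" using V(2)[OF x(1)] by simp
    then show ?thesis using inj[of w] by (simp add: v_def)
  qed
  then have "\<exists>B. B ** ?G = mat 1" by (simp add: matrix_left_invertible_ker)
  then show ?thesis
    using invertible_det_nz invertible_left_inverse by blast
qed

text \<open>By interpolation the vector with coordinates \<open>- sgn h(S)\<^sup>k\<close> on \<open>I\<close> belongs to the unit
  ball of \<open>V\<close>, and its coordinate \<open>k\<close> is the sum to be estimated.\<close>
lemma h_vec_bound_of_norming:
  fixes F :: "real ^ 'm::finite ^ 'N::finite"
  assumes V: "subspace V" "\<And>x. x \<in> V \<Longrightarrow> transpose F *v x = 0"
    and I: "norming I V" "card I = dim V" and card: "card (- I) = CARD('m)"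
    and det: "det (row_submatrix F (- I)) \<noteq> 0" and k: "k \<in> - I"
  shows "(\<Sum>i\<in>UNIV. \<bar>h_vec F (- I) k $ i\<bar>) \<le> 2"
proof -
  obtain x where x: "x \<in> V" "\<And>i. i \<in> I \<Longrightarrow> x $ i = - sgn (h_vec F (- I) k $ i)"
    using norming_interpolation[OF V(1) I, of "\<lambda>i. - sgn (h_vec F (- I) k $ i)"] by blast
  have "x $ k = (\<Sum>i\<in>I. \<bar>h_vec F (- I) k $ i\<bar>)"
    using h_vec_solves_coordinate[OF card det V(2)[OF x(1)] k] x(2)
    by (simp add: sum_negf[symmetric] abs_sgn)
  moreover have "\<bar>x $ k\<bar> \<le> 1"
    by (rule norming_bound[OF I(1) x(1)]) (simp add: x(2) abs_sgn_eq)
  ultimately show ?thesis using h_vec_l1_norm[OF card det k] by simp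
qed

section \<open>Norming sets from isomorphisms with small distortion\<close>

lemma linear_iso_extension:
  fixes V :: "(real ^ 'a::finite) set" and T :: "real ^ 'a \<Rightarrow> real ^ 'b::finite"
  assumes "subspace V" "linear_iso_betw T V W"
  obtains g where "linear g" "\<And>x. x \<in> V \<Longrightarrow> g x = T x"
proof -
  have "\<And>x y. x \<in> V \<Longrightarrow> y \<in> V \<Longrightarrow> T (x + y) = T x + T y"
    and "\<And>c x. x \<in> V \<Longrightarrow> T (c *\<^sub>R x) = c *\<^sub>R T x"
    using assms(2) unfolding linear_iso_betw_def by auto
  from linear_extension_from_subspace[OF assms(1) this] show ?thesis using that by blast
qed

lemma linear_iso_inverse:
  fixes V :: "(real ^ 'a::finite) set" and T :: "real ^ 'a \<Rightarrow> real ^ 'b::finite"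
  assumes V: "subspace V" and T: "linear_iso_betw T V UNIV"
  shows "linear (inv_into V T)" "inv_into V T y \<in> V" "T (inv_into V T y) = y"
    "x \<in> V \<Longrightarrow> inv_into V T (T x) = x"
proof -
  have bij: "bij_betw T V UNIV" and add: "\<And>x y. x \<in> V \<Longrightarrow> y \<in> V \<Longrightarrow> T (x + y) = T x + T y"
    and scale: "\<And>c x. x \<in> V \<Longrightarrow> T (c *\<^sub>R x) = c *\<^sub>R T x"
    using T unfolding linear_iso_betw_def by auto
  have inV: "inv_into V T y \<in> V" and right: "T (inv_into V T y) = y" for y
    using bij bij_betw_inv_into_right[OF bij, of y] inv_into_into[of y T V]
    by (auto simp: bij_betw_def)
  have left: "inv_into V T (T x) = x" if "x \<in> V" for x
    by (rule bij_betw_inv_into_left[OF bij that])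
  show "linear (inv_into V T)"
  proof (rule linearI)
    fix y z c
    show "inv_into V T (y + z) = inv_into V T y + inv_into V T z"
      by (metis add inV left right subspace_add[OF V])
    show "inv_into V T (c *\<^sub>R y) = c *\<^sub>R inv_into V T y"
      by (metis scale inV left right subspace_scale[OF V])
  qed
  show "inv_into V T y \<in> V" "T (inv_into V T y) = y"
    "x \<in> V \<Longrightarrow> inv_into V T (T x) = x"
    by (fact inV right left)+
qed

lemma linear_iso_infnorm_bounds:
  fixes V :: "(real ^ 'a::finite) set" and T :: "real ^ 'a \<Rightarrow> real ^ 'b::finite"
  assumes V: "subspace V" and T: "linear_iso_betw T V UNIV"
  shows "x \<in> V \<Longrightarrow> infnorm (T x) \<le> linf_opnorm V T * infnorm x"
    and "infnorm (inv_into V T y) \<le> linf_opnorm UNIV (inv_into V T) * infnorm y"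
proof -
  obtain g where "linear g" "\<And>x. x \<in> V \<Longrightarrow> g x = T x"
    using linear_iso_extension[OF V T] by blast
  then show "infnorm (T x) \<le> linf_opnorm V T * infnorm x" if "x \<in> V"
    using infnorm_le_linf_opnorm[OF V] that by blast
  show "infnorm (inv_into V T y) \<le> linf_opnorm UNIV (inv_into V T) * infnorm y"
    by (rule infnorm_le_linf_opnorm[OF subspace_UNIV linear_iso_inverse(1)[OF V T]]) auto
qed

lemma linear_iso_distortion_ge_1:
  fixes V :: "(real ^ 'a::finite) set" and T :: "real ^ 'a \<Rightarrow> real ^ 'b::finite"
  assumes V: "subspace V" and T: "linear_iso_betw T V UNIV"
  shows "linf_opnorm V T > 0" "linf_opnorm UNIV (inv_into V T) > 0"
    "linf_opnorm V T * linf_opnorm UNIV (inv_into V T) \<ge> 1"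
proof -
  define \<alpha> where "\<alpha> = linf_opnorm V T"
  define \<beta> where "\<beta> = linf_opnorm UNIV (inv_into V T)"
  note inv = linear_iso_inverse[OF V T]
  define y :: "real ^ 'b" where "y = (\<chi> j. 1)"
  define x where "x = inv_into V T y"
  have y: "infnorm y = 1" by (rule infnorm_attained_cart[of y]) (simp add: y_def)
  have 1: "1 \<le> \<alpha> * infnorm x"
    using linear_iso_infnorm_bounds(1)[OF V T, of x] inv y by (simp add: x_def \<alpha>_def)
  have 2: "infnorm x \<le> \<beta>"
    using linear_iso_infnorm_bounds(2)[OF V T, of y] y by (simp add: x_def \<beta>_def)
  have x: "infnorm x > 0"
    using 1 infnorm_pos_le[of x] by (cases "infnorm x = 0") auto
  show pos: "\<alpha> > 0" using 1 x by (metis less_le_trans zero_less_mult_pos2 zero_less_one)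
  show "\<beta> > 0" using 2 x by linarith
  have "\<alpha> * infnorm x \<le> \<alpha> * \<beta>" using 2 pos by simp
  then show "\<alpha> * \<beta> \<ge> 1" using 1 by linarith
qed

text \<open>Let \<open>a\<close> be the matrix of \<open>T\<^sup>-\<^sup>1\<close>. Its column \<open>j\<close> has an entry of absolute value at least
  \<open>1 / \<parallel>T\<parallel>\<close>, say in row \<open>e j\<close>, while the row sums are at most \<open>\<parallel>T\<^sup>-\<^sup>1\<parallel>\<close>. If the distortion is
  close to 1, this leaves little for the rest of row \<open>e j\<close>, and the coordinate \<open>e j\<close> on \<open>V\<close> is
  close to a multiple of the coordinate \<open>j\<close> of \<open>T\<close>.\<close>
lemma almost_norming_of_linear_iso:
  fixes V :: "(real ^ 'a::finite) set" and T :: "real ^ 'a \<Rightarrow> real ^ 'b::finite"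
  assumes V: "subspace V" and T: "linear_iso_betw T V UNIV"
    and q: "linf_opnorm V T * linf_opnorm UNIV (inv_into V T) = q" "q < 2"
  obtains I where "card I \<le> CARD('b)"
    "\<And>x. x \<in> V \<Longrightarrow> \<exists>j\<in>I. (2 / q - 1) * infnorm x \<le> \<bar>x $ j\<bar>"
proof -
  define \<alpha> where "\<alpha> = linf_opnorm V T"
  define \<beta> where "\<beta> = linf_opnorm UNIV (inv_into V T)"
  define U where "U = inv_into V T"
  have pos: "\<alpha> > 0" "\<beta> > 0" and q': "q = \<alpha> * \<beta>"
    using linear_iso_distortion_ge_1[OF V T] q by (auto simp: \<alpha>_def \<beta>_def)
  note inv = linear_iso_inverse[OF V T, folded U_def]
  note bounds = linear_iso_infnorm_bounds[OF V T, folded U_def, folded \<alpha>_def]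
  have Ubound: "infnorm (U y) \<le> \<beta> * infnorm y" for y
    using bounds(2)[of y] by (simp add: \<beta>_def U_def)
  have "\<exists>i. \<bar>U (axis j 1) $ i\<bar> \<ge> 1 / \<alpha>" for j
  proof -
    have "1 \<le> infnorm (axis j (1::real) :: real ^ 'b)"
      using component_le_infnorm_cart[of "axis j (1::real) :: real ^ 'b" j] by simp
    also have "\<dots> \<le> \<alpha> * infnorm (U (axis j 1))"
      using bounds(1)[of "U (axis j 1)"] inv by simp
    finally have "infnorm (U (axis j 1)) \<ge> 1 / \<alpha>" using pos by (simp add: field_simps)
    then show ?thesis by (metis infnorm_attained_cart)
  qed
  then obtain e where e: "\<And>j. \<bar>U (axis j 1) $ e j\<bar> \<ge> 1 / \<alpha>" by metis
  show ?thesis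
  proof (rule that[of "range e"])
    show "card (range e) \<le> CARD('b)" by (rule card_image_le) simp
    fix x assume x: "x \<in> V"
    define y where "y = T x"
    have xy: "x = U y" using inv x by (simp add: y_def)
    obtain j where j: "infnorm y = \<bar>y $ j\<bar>" by (rule infnorm_attained_cart)
    define a where "a = (\<lambda>k. U (axis k 1) $ e j)"
    have sum_a: "(\<Sum>k\<in>UNIV - {j}. \<bar>a k\<bar>) \<le> \<beta> - 1 / \<alpha>"
      using abs_row_sum_le[OF inv(1) Ubound, of "e j"] e[of j] sum.remove[of UNIV j "\<lambda>k. \<bar>a k\<bar>"]
      by (simp add: a_def)
    have "x $ e j = a j * y $ j + (\<Sum>k\<in>UNIV - {j}. a k * y $ k)"
      unfolding xy linear_component_sum[OF inv(1), of y] a_def by (rule sum.remove) auto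
    moreover have "\<bar>\<Sum>k\<in>UNIV - {j}. a k * y $ k\<bar> \<le> (\<beta> - 1 / \<alpha>) * infnorm y"
    proof -
      have "\<bar>\<Sum>k\<in>UNIV - {j}. a k * y $ k\<bar> \<le> (\<Sum>k\<in>UNIV - {j}. \<bar>a k\<bar> * infnorm y)"
        by (intro order_trans[OF sum_abs] sum_mono)
          (simp add: abs_mult mult_left_mono component_le_infnorm_cart)
      also have "\<dots> = (\<Sum>k\<in>UNIV - {j}. \<bar>a k\<bar>) * infnorm y" by (simp add: sum_distrib_right)
      also have "\<dots> \<le> (\<beta> - 1 / \<alpha>) * infnorm y"
        using sum_a infnorm_pos_le by (rule mult_right_mono)
      finally show ?thesis .
    qed
    moreover have "\<bar>a j * y $ j\<bar> \<ge> (1 / \<alpha>) * infnorm y"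
      unfolding j abs_mult a_def using e[of j] by (intro mult_right_mono) auto
    ultimately have "\<bar>x $ e j\<bar> \<ge> (1 / \<alpha>) * infnorm y - (\<beta> - 1 / \<alpha>) * infnorm y" by linarith
    also have "(1 / \<alpha>) * infnorm y - (\<beta> - 1 / \<alpha>) * infnorm y = (2 / q - 1) * (\<beta> * infnorm y)"
      using pos by (simp add: q' field_simps)
    finally have "(2 / q - 1) * (\<beta> * infnorm y) \<le> \<bar>x $ e j\<bar>" .
    moreover have "(2 / q - 1) * infnorm x \<le> (2 / q - 1) * (\<beta> * infnorm y)"
      using Ubound[of y] q(2) pos by (intro mult_left_mono) (auto simp: xy q' field_simps)
    ultimately show "\<exists>j\<in>range e. (2 / q - 1) * infnorm x \<le> \<bar>x $ j\<bar>"
      using order_trans by blast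
  qed
qed

text \<open>There are only finitely many sets of coordinates, and each set that is not norming
  misses the norm of some vector by a fixed factor, which excludes all \<open>\<theta>\<close> close to 1.\<close>
lemma norming_of_almost_norming:
  fixes V :: "(real ^ 'a::finite) set"
  assumes almost: "\<And>\<theta>. \<theta> < 1 \<Longrightarrow>
      \<exists>I. card I \<le> n \<and> (\<forall>x\<in>V. \<exists>j\<in>I. \<theta> * infnorm x \<le> \<bar>x $ j\<bar>)"
  obtains I where "card I \<le> n" "norming I V"
proof (rule ccontr)
  assume no_thesis: "\<not> thesis"
  have none: "\<not> norming I V" if "card I \<le> n" for I
    using no_thesis that \<open>\<And>I. card I \<le> n \<Longrightarrow> norming I V \<Longrightarrow> thesis\<close> by blast
  define F where "F = {I :: 'a set. card I \<le> n}"
  have "eventually (\<lambda>\<theta>. \<exists>x\<in>V. \<forall>j\<in>I. \<bar>x $ j\<bar> < \<theta> * infnorm x) (at_left (1::real))" if "I \<in> F" for I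
  proof -
    obtain x i where x: "x \<in> V" "\<And>j. j \<in> I \<Longrightarrow> \<bar>x $ j\<bar> < \<bar>x $ i\<bar>"
      using none[of I] \<open>I \<in> F\<close> unfolding norming_def F_def by (auto simp: not_le)
    have "((\<lambda>\<theta>. \<theta> * infnorm x) \<longlongrightarrow> 1 * infnorm x) (at_left (1::real))"
      by (intro tendsto_intros)
    moreover have "\<bar>x $ j\<bar> < 1 * infnorm x" if "j \<in> I" for j
      using x(2)[OF that] component_le_infnorm_cart[of x i] by linarith
    ultimately have "\<forall>j\<in>I. eventually (\<lambda>\<theta>. \<bar>x $ j\<bar> < \<theta> * infnorm x) (at_left (1::real))"
      using order_tendstoD(1) by blast
    then have "eventually (\<lambda>\<theta>. \<forall>j\<in>I. \<bar>x $ j\<bar> < \<theta> * infnorm x) (at_left (1::real))"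
      by (intro eventually_ball_finite) auto
    then show ?thesis by (rule eventually_mono) (use x(1) in auto)
  qed
  then have "eventually (\<lambda>\<theta>. \<forall>I\<in>F. \<exists>x\<in>V. \<forall>j\<in>I. \<bar>x $ j\<bar> < \<theta> * infnorm x) (at_left (1::real))"
    by (intro eventually_ball_finite) auto
  moreover have "eventually (\<lambda>\<theta>::real. \<theta> < 1) (at_left 1)"
    by (simp add: eventually_at_filter)
  ultimately have "eventually (\<lambda>\<theta>. \<theta> < 1 \<and>
      (\<forall>I\<in>F. \<exists>x\<in>V. \<forall>j\<in>I. \<bar>x $ j\<bar> < \<theta> * infnorm x)) (at_left (1::real))"
    by eventually_elim auto
  from eventually_happens'[OF trivial_limit_at_left_real this]
  obtain \<theta> :: real where \<theta>: "\<theta> < 1"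
      and F: "\<And>I. I \<in> F \<Longrightarrow> \<exists>x\<in>V. \<forall>j\<in>I. \<bar>x $ j\<bar> < \<theta> * infnorm x" by blast
  obtain I where I: "I \<in> F" "\<And>x. x \<in> V \<Longrightarrow> \<exists>j\<in>I. \<theta> * infnorm x \<le> \<bar>x $ j\<bar>"
    using almost[OF \<theta>] unfolding F_def by blast
  obtain x where x: "x \<in> V" "\<And>j. j \<in> I \<Longrightarrow> \<bar>x $ j\<bar> < \<theta> * infnorm x"
    using F[OF I(1)] by blast
  then obtain j where "j \<in> I" "\<theta> * infnorm x \<le> \<bar>x $ j\<bar>" using I(2) by blast
  with x(2) show False by fastforce
qed

lemma ex_linear_iso:
  fixes V :: "(real ^ 'a::finite) set"
  assumes "subspace V" "dim V = CARD('b::finite)"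
  shows "\<exists>T :: real ^ 'a \<Rightarrow> real ^ 'b. linear_iso_betw T V UNIV"
proof -
  have "dim V = dim (UNIV :: (real ^ 'b) set)" using assms(2) by simp
  then obtain f g where f: "linear f" "f ` V = (UNIV :: (real ^ 'b) set)"
      and "\<And>x. x \<in> V \<Longrightarrow> g (f x) = x"
    using isometries_subspaces[OF assms(1) subspace_UNIV, where ?'b = "real ^ 'b"]
    by (metis (no_types, lifting))
  then have "bij_betw f V UNIV" unfolding bij_betw_def by (blast intro: inj_on_inverseI)
  then show ?thesis
    unfolding linear_iso_betw_def using linear_add[OF f(1)] linear_scale[OF f(1)] by blast
qed

lemma norming_of_banach_mazur_1:
  fixes V :: "(real ^ 'a::finite) set"
  assumes V: "subspace V" and dim: "dim V = CARD('b::finite)"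
    and bm: "banach_mazur V (UNIV :: (real ^ 'b) set) = 1"
  shows "\<exists>I. card I = dim V \<and> norming I V"
proof -
  have "\<exists>I. card I \<le> dim V \<and> (\<forall>x\<in>V. \<exists>j\<in>I. \<theta> * infnorm x \<le> \<bar>x $ j\<bar>)" if \<theta>: "\<theta> < 1" for \<theta>
  proof -
    \<comment> \<open>Replacing \<open>\<theta>\<close> by a larger nonnegative number only strengthens the claim.\<close>
    define r where "r = max \<theta> 0"
    define D where "D = {linf_opnorm V T * linf_opnorm (UNIV :: (real ^ 'b) set) (inv_into V T) |T.
      linear_iso_betw T V UNIV}"
    have r: "0 \<le> r" "r < 1" "\<theta> \<le> r" using \<theta> by (auto simp: r_def)
    obtain T\<^sub>0 :: "real ^ 'a \<Rightarrow> real ^ 'b" where "linear_iso_betw T\<^sub>0 V UNIV"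
      using ex_linear_iso[OF V dim] by blast
    then have "D \<noteq> {}" unfolding D_def by blast
    \<comment> \<open>The bound is the \<open>q\<close> for which \<open>2 / q - 1 = r\<close>.\<close>
    moreover have "Inf D < 2 / (1 + r)"
      using bm r unfolding banach_mazur_def D_def[symmetric] by (simp add: field_simps)
    ultimately obtain d where "d \<in> D" and d: "d < 2 / (1 + r)"
      using cInf_lessD by metis
    then obtain T :: "real ^ 'a \<Rightarrow> real ^ 'b" where T: "linear_iso_betw T V UNIV"
        "linf_opnorm V T * linf_opnorm UNIV (inv_into V T) = d" unfolding D_def by auto
    have "d \<ge> 1" using linear_iso_distortion_ge_1(3)[OF V T(1)] T(2) by simp
    moreover have "d * (1 + r) < 2" using d r by (simp add: field_simps)
    moreover have "d * 1 \<le> d * (1 + r)" using \<open>d \<ge> 1\<close> r by (intro mult_left_mono) auto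
    ultimately have "r \<le> 2 / d - 1" "d < 2" by (auto simp: field_simps)
    then have dr: "\<theta> \<le> 2 / d - 1" "d < 2" using r by auto
    obtain I where I: "card I \<le> CARD('b)"
        "\<And>x. x \<in> V \<Longrightarrow> \<exists>j\<in>I. (2 / d - 1) * infnorm x \<le> \<bar>x $ j\<bar>"
      using almost_norming_of_linear_iso[OF V T dr(2)] by blast
    have "\<exists>j\<in>I. \<theta> * infnorm x \<le> \<bar>x $ j\<bar>" if "x \<in> V" for x
      using I(2)[OF that] mult_right_mono[OF dr(1) infnorm_pos_le[of x]] order_trans by blast
    then show ?thesis using I(1) dim by auto
  qed
  then obtain I where "card I \<le> dim V" "norming I V"
    by (rule norming_of_almost_norming)
  then show ?thesis using norming_dim_le_card[OF V] by (metis le_antisym)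
qed

lemma isometrically_isomorphic_of_norming:
  fixes V :: "(real ^ 'a::finite) set"
  assumes V: "subspace V" and I: "norming I V" "card I = dim V" and dim: "dim V = CARD('b::finite)"
  shows "isometrically_isomorphic V (UNIV :: (real ^ 'b) set)"
proof -
  obtain e :: "'b \<Rightarrow> 'a" where e: "bij_betw e UNIV I"
    using finite_same_card_bij[of "UNIV :: 'b set" I] I(2) dim by auto
  then have eI: "e j \<in> I" for j by (auto simp: bij_betw_def)
  define T :: "real ^ 'a \<Rightarrow> real ^ 'b" where "T x = (\<chi> j. x $ e j)" for x
  have onI: "\<exists>j. e j = i" if "i \<in> I" for i using e that by (auto simp: bij_betw_def)
  have "inj_on T V"
  proof (rule inj_onI)
    fix x y assume xy: "x \<in> V" "y \<in> V" "T x = T y"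
    then have "x $ i = y $ i" if "i \<in> I" for i
      using onI[OF that] by (auto simp: T_def vec_eq_iff)
    then have "truncate I x = truncate I y" by (auto simp: truncate_def vec_eq_iff)
    then show "x = y"
      using norming_inj_on_truncate[OF V I(1)] xy by (auto dest: inj_onD)
  qed
  moreover have "T ` V = UNIV"
  proof -
    have "y \<in> T ` V" for y
    proof -
      obtain x where x: "x \<in> V" "\<And>i. i \<in> I \<Longrightarrow> x $ i = y $ inv_into UNIV e i"
        using norming_interpolation[OF V I, of "\<lambda>i. y $ inv_into UNIV e i"] by blast
      have "T x = y"
        using e by (simp add: T_def vec_eq_iff x(2)[OF eI] inv_into_f_f bij_betw_def)
      then show ?thesis using x(1) by blast
    qed
    then show ?thesis by blast
  qed
  moreover have "infnorm (T x) = infnorm x" if "x \<in> V" for x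
  proof (rule antisym)
    show "infnorm (T x) \<le> infnorm x"
      by (simp add: infnorm_le_iff_cart T_def component_le_infnorm_cart)
    have "\<bar>x $ j\<bar> \<le> infnorm (T x)" if "j \<in> I" for j
      using onI[OF that] component_le_infnorm_cart[of "T x"] by (auto simp: T_def)
    then show "infnorm x \<le> infnorm (T x)"
      using norming_bound[OF I(1) \<open>x \<in> V\<close>] by (simp add: infnorm_le_iff_cart)
  qed
  ultimately have "linear_iso_betw T V UNIV \<and> (\<forall>x\<in>V. infnorm (T x) = infnorm x)"
    unfolding linear_iso_betw_def bij_betw_def by (simp add: T_def vec_eq_iff)
  then show ?thesis unfolding isometrically_isomorphic_def by blast
qed

lemma banach_mazur_of_isometrically_isomorphic:
  fixes V :: "(real ^ 'a::finite) set"
  assumes V: "subspace V" and iso: "isometrically_isomorphic V (UNIV :: (real ^ 'b::finite) set)"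
  shows "banach_mazur V (UNIV :: (real ^ 'b) set) = 1"
proof -
  obtain T :: "real ^ 'a \<Rightarrow> real ^ 'b" where T: "linear_iso_betw T V UNIV"
      and isom: "\<And>x. x \<in> V \<Longrightarrow> infnorm (T x) = infnorm x"
    using iso unfolding isometrically_isomorphic_def by blast
  note inv = linear_iso_inverse[OF V T]
  have "linf_opnorm V T \<le> 1"
    by (rule linf_opnorm_le[OF V]) (simp_all add: isom)
  moreover have "linf_opnorm UNIV (inv_into V T) \<le> 1"
    by (rule linf_opnorm_le[OF subspace_UNIV])
      (simp_all add: isom[symmetric] inv)
  ultimately have "linf_opnorm V T * linf_opnorm UNIV (inv_into V T) \<le> 1"
    using linear_iso_distortion_ge_1[OF V T] by (intro mult_le_one) auto
  then have "linf_opnorm V T * linf_opnorm UNIV (inv_into V T) = 1"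
    using linear_iso_distortion_ge_1(3)[OF V T] by linarith
  then show ?thesis
    unfolding banach_mazur_def using T linear_iso_distortion_ge_1(3)[OF V]
    by (intro cInf_eq_minimum) (auto intro!: exI[of _ T])
qed

section \<open>Norming sets and projections of norm 1\<close>

lemma nonzero_vector_of_dim_pos:
  fixes V :: "(real ^ 'a::finite) set"
  assumes "dim V > 0"
  obtains x where "x \<in> V" "x \<noteq> 0"
proof -
  have "\<not> V \<subseteq> {0}"
  proof
    assume "V \<subseteq> {0}"
    then have "dim V = 0" by (simp only: dim_eq_0)
    then show False using assms by linarith
  qed
  then show ?thesis using that by auto
qed

lemma linf_opnorm_projection_ge_1:
  fixes V :: "(real ^ 'a::finite) set"
  assumes P: "linear_projection_onto P V" and V: "dim V > 0"
  shows "linf_opnorm UNIV P \<ge> 1"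
proof -
  obtain x where x: "x \<in> V" "x \<noteq> 0" using nonzero_vector_of_dim_pos[OF V] .
  have "linear P" using P by (simp add: linear_projection_onto_def)
  then have "infnorm (P x) \<le> linf_opnorm UNIV P * infnorm x"
    by (intro infnorm_le_linf_opnorm[OF subspace_UNIV]) auto
  then show ?thesis
    using projection_fixes_range[OF P x(1)] x(2) by (simp add: infnorm_pos_lt)
qed

text \<open>The projection replaces \<open>y\<close> by the vector of \<open>V\<close> with the same coordinates on \<open>I\<close>.\<close>
lemma projection_constant_of_norming:
  fixes V :: "(real ^ 'a::finite) set"
  assumes V: "subspace V" "dim V > 0" and I: "norming I V" "card I = dim V"
  shows "projection_constant V = 1"
proof -
  obtain g where g: "range g \<subseteq> V" "linear g" "\<And>v. v \<in> V \<Longrightarrow> g (truncate I v) = v"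
    using linear_exists_left_inverse_on[OF linear_truncate V(1) norming_inj_on_truncate[OF V(1) I(1)]]
    by blast
  define P where "P = g \<circ> truncate I"
  have inV: "P y \<in> V" for y using g(1) by (auto simp: P_def)
  have fixV: "P v = v" if "v \<in> V" for v using g(3)[OF that] by (simp add: P_def)
  have "range P = V" using inV fixV by (auto simp: image_iff) metis
  then have proj: "linear_projection_onto P V"
    unfolding linear_projection_onto_def using linear_compose[OF linear_truncate g(2)] inV fixV
    by (auto simp: P_def fun_eq_iff)
  have agree: "P y $ i = y $ i" if "i \<in> I" for y i
  proof -
    obtain v where v: "v \<in> V" "\<And>i. i \<in> I \<Longrightarrow> v $ i = y $ i"
      using norming_interpolation[OF V(1) I, of "\<lambda>i. y $ i"] by blast
    have "truncate I y = truncate I v" using v(2) by (simp add: truncate_def vec_eq_iff)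
    then have "P y = v" using g(3)[OF v(1)] by (simp add: P_def)
    then show ?thesis using v(2) that by simp
  qed
  have "infnorm (P y) \<le> infnorm y" for y
    unfolding infnorm_le_iff_cart[of "P y"]
    using norming_bound[OF I(1) inV[of y], of "infnorm y"] agree component_le_infnorm_cart[of y]
    by auto
  then have "linf_opnorm UNIV P \<le> 1" by (intro linf_opnorm_le) auto
  then have "linf_opnorm UNIV P = 1" using linf_opnorm_projection_ge_1[OF proj V(2)] by simp
  then show ?thesis
    unfolding projection_constant_def using proj linf_opnorm_projection_ge_1[OF _ V(2)]
    by (intro cInf_eq_minimum) (auto intro!: exI[of _ P])
qed

lemma norm_matrix_le_row_sums:
  fixes A :: "real ^ 'a::finite ^ 'b::finite"
  assumes "\<And>i. (\<Sum>j\<in>UNIV. \<bar>A $ i $ j\<bar>) \<le> c"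
  shows "norm A \<le> real CARD('b) * c"
proof -
  have "norm A \<le> (\<Sum>i\<in>UNIV. norm (A $ i))"
    unfolding norm_vec_def by (rule L2_set_le_sum) simp
  also have "\<dots> \<le> (\<Sum>i\<in>(UNIV :: 'b set). c)"
    by (intro sum_mono order_trans[OF norm_le_l1_cart assms])
  finally show ?thesis by simp
qed

text \<open>The matrices of projections onto \<open>V\<close> with norm close to 1 accumulate at the matrix of a
  projection of norm 1.\<close>
lemma minimal_projection_exists:
  fixes V :: "(real ^ 'a::finite) set"
  assumes V: "subspace V" and const: "projection_constant V = 1"
  obtains P where "linear P" "\<And>x. P x \<in> V" "\<And>x. x \<in> V \<Longrightarrow> P x = x"
    "\<And>x. infnorm (P x) \<le> infnorm x"
proof -
  define c where "c k = 1 + 1 / real (Suc k)" for k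
  have "\<exists>P. linear_projection_onto P V \<and> linf_opnorm UNIV P < c k" for k
  proof -
    define D where "D = {linf_opnorm UNIV P |P. linear_projection_onto P V}"
    have "D \<noteq> {}" using ex_linear_projection_onto[OF V] by (auto simp: D_def)
    moreover have "Inf D < c k"
      using const by (simp add: projection_constant_def D_def c_def)
    ultimately obtain d where "d \<in> D" "d < c k" using cInf_lessD by metis
    then show ?thesis by (auto simp: D_def)
  qed
  then obtain P where P: "\<And>k. linear_projection_onto (P k) V"
      and norm: "\<And>k. linf_opnorm UNIV (P k) < c k" by metis
  have lin: "linear (P k)" and inV: "P k x \<in> V" for k x
    using P[of k] by (auto simp: linear_projection_onto_def)
  have fixV: "P k x = x" if "x \<in> V" for k x by (rule projection_fixes_range[OF P that])
  have bound: "infnorm (P k x) \<le> c k * infnorm x" for k x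
  proof -
    have "infnorm (P k x) \<le> linf_opnorm UNIV (P k) * infnorm x"
      by (rule infnorm_le_linf_opnorm[OF subspace_UNIV lin]) auto
    also have "\<dots> \<le> c k * infnorm x"
      using norm[of k] infnorm_pos_le by (intro mult_right_mono) auto
    finally show ?thesis .
  qed
  define A where "A k = matrix (P k)" for k
  have PA: "P k x = A k *v x" for k x
    using lin[of k] by (simp add: A_def matrix_works)
  have "norm (A k) \<le> real CARD('a) * 2" for k
  proof (rule norm_matrix_le_row_sums)
    fix i
    have "(\<Sum>j\<in>UNIV. \<bar>A k $ i $ j\<bar>) \<le> c k"
      using abs_row_sum_le[OF lin bound, where i = i] by (simp add: A_def matrix_def)
    also have "c k \<le> 2" by (simp add: c_def)
    finally show "(\<Sum>j\<in>UNIV. \<bar>A k $ i $ j\<bar>) \<le> 2" .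
  qed
  then have "bounded (range A)" by (auto simp: bounded_iff)
  then obtain L r where r: "strict_mono (r :: nat \<Rightarrow> nat)" and L: "(A \<circ> r) \<longlonglongrightarrow> L"
    using bounded_imp_convergent_subsequence by blast
  have lim: "(\<lambda>k. P (r k) x) \<longlonglongrightarrow> L *v x" for x
  proof (rule vec_tendstoI)
    fix i
    have "(\<lambda>k. \<Sum>j\<in>UNIV. (A \<circ> r) k $ i $ j * x $ j) \<longlonglongrightarrow> (\<Sum>j\<in>UNIV. L $ i $ j * x $ j)"
      by (intro tendsto_intros tendsto_vec_nth L)
    then show "(\<lambda>k. P (r k) x $ i) \<longlonglongrightarrow> (L *v x) $ i"
      by (simp add: PA matrix_vector_mult_def)
  qed
  have c: "(\<lambda>k. c (r k)) \<longlonglongrightarrow> 1"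
  proof -
    have "c \<longlonglongrightarrow> 1 + 0"
      unfolding c_def by (intro tendsto_intros LIMSEQ_Suc lim_1_over_n)
    then show ?thesis using LIMSEQ_subseq_LIMSEQ[OF _ r, of c 1] by (simp add: o_def)
  qed
  show ?thesis
  proof (rule that[of "\<lambda>x. L *v x"])
    show "linear (\<lambda>x. L *v x)" by simp
    show "L *v x \<in> V" for x
      using closed_sequentially[OF closed_subspace[OF V] inV lim] .
    show "L *v x = x" if "x \<in> V" for x
      using lim[of x] fixV[OF that] by (simp add: LIMSEQ_const_iff)
    show "infnorm (L *v x) \<le> infnorm x" for x
      unfolding infnorm_le_iff_cart
    proof
      fix i
      have "(\<lambda>k. \<bar>P (r k) x $ i\<bar>) \<longlonglongrightarrow> \<bar>(L *v x) $ i\<bar>"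
        by (intro tendsto_intros tendsto_vec_nth lim)
      moreover have "(\<lambda>k. c (r k) * infnorm x) \<longlonglongrightarrow> 1 * infnorm x"
        by (intro tendsto_intros c)
      moreover have "\<bar>P (r k) x $ i\<bar> \<le> c (r k) * infnorm x" for k
        using component_le_infnorm_cart bound order_trans by blast
      ultimately show "\<bar>(L *v x) $ i\<bar> \<le> infnorm x"
        using LIMSEQ_le by fastforce
    qed
  qed
qed

text \<open>The coordinate \<open>x\<^sub>i\<close> of \<open>x = P x\<close> is the sum of the \<open>a\<^sub>i\<^sub>j x\<^sub>j\<close>, where the absolute values of
  the \<open>a\<^sub>i\<^sub>j\<close> add up to at most 1 and no \<open>\<bar>x\<^sub>j\<bar>\<close> exceeds \<open>x\<^sub>i\<close>. So nothing may be lost in any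
  term.\<close>
lemma row_support_at_peak:
  fixes x :: "real ^ 'a::finite"
  assumes sum: "(\<Sum>j\<in>UNIV. a j * x $ j) = x $ i" and abs: "(\<Sum>j\<in>UNIV. \<bar>a j\<bar>) \<le> 1"
    and peak: "\<And>j. \<bar>x $ j\<bar> \<le> x $ i" and j: "a j \<noteq> 0"
  shows "x $ j = sgn (a j) * x $ i"
proof -
  have nonneg: "\<bar>a l\<bar> * x $ i - a l * x $ l \<ge> 0" for l
  proof -
    have "a l * x $ l \<le> \<bar>a l\<bar> * \<bar>x $ l\<bar>" by (metis abs_ge_self abs_mult)
    also have "\<dots> \<le> \<bar>a l\<bar> * x $ i" using peak by (intro mult_left_mono) auto
    finally show ?thesis by simp
  qed
  have "(\<Sum>l\<in>UNIV. \<bar>a l\<bar> * x $ i - a l * x $ l) = (\<Sum>l\<in>UNIV. \<bar>a l\<bar>) * x $ i - x $ i"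
    by (simp add: sum_subtractf sum sum_distrib_right)
  also have "\<dots> \<le> 0"
    using mult_right_mono[OF abs, of "x $ i"] peak[of i] by simp
  finally have "(\<Sum>l\<in>UNIV. \<bar>a l\<bar> * x $ i - a l * x $ l) = 0"
    using nonneg by (simp add: order_antisym sum_nonneg)
  then have "\<bar>a j\<bar> * x $ i = a j * x $ j"
    using nonneg by (simp add: sum_nonneg_eq_0_iff)
  then have "a j * (x $ j) = a j * (sgn (a j) * x $ i)"
    by (simp only: abs_sgn mult.assoc)
  then show ?thesis using j by simp
qed

text \<open>The strict peak of \<open>x\<close> at \<open>i\<close> survives a small perturbation in the direction of any
  \<open>z \<in> V\<close>. The conclusion, known at peaks, is linear, so it holds for \<open>z\<close> as well.\<close>
lemma row_support_of_strict_peak: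
  fixes V :: "(real ^ 'a::finite) set"
  assumes V: "subspace V" and I: "norming I V"
    and sum: "\<And>x. x \<in> V \<Longrightarrow> (\<Sum>j\<in>UNIV. a j * x $ j) = x $ i" and abs: "(\<Sum>j\<in>UNIV. \<bar>a j\<bar>) \<le> 1"
    and x: "x \<in> V" "x $ i > 0" "\<And>j. j \<in> I - {i} \<Longrightarrow> \<bar>x $ j\<bar> < x $ i"
    and j: "a j \<noteq> 0" and z: "z \<in> V"
  shows "z $ j = sgn (a j) * z $ i"
proof -
  have peak: "w $ j = sgn (a j) * w $ i"
    if w: "w \<in> V" "w $ i > 0" "\<And>l. l \<in> I - {i} \<Longrightarrow> \<bar>w $ l\<bar> < w $ i" for w
  proof (rule row_support_at_peak[OF sum[OF w(1)] abs _ j])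
    show "\<bar>w $ l\<bar> \<le> w $ i" for l
    proof (rule norming_bound[OF I w(1)])
      show "\<bar>w $ l\<bar> \<le> w $ i" if "l \<in> I" for l
        using w(2) w(3)[of l] that by (cases "l = i") auto
    qed
  qed
  have lim: "((\<lambda>t. (x + t *\<^sub>R z) $ l) \<longlongrightarrow> x $ l) (at_right 0)" for l
  proof -
    have "((\<lambda>t. x $ l + t * z $ l) \<longlongrightarrow> x $ l + 0 * z $ l) (at_right 0)"
      by (intro tendsto_intros)
    then show ?thesis by simp
  qed
  have "\<forall>l\<in>I - {i}. eventually (\<lambda>t. \<bar>(x + t *\<^sub>R z) $ l\<bar> < (x + t *\<^sub>R z) $ i) (at_right 0)"
  proof
    fix l assume "l \<in> I - {i}"
    have "((\<lambda>t. (x + t *\<^sub>R z) $ i - \<bar>(x + t *\<^sub>R z) $ l\<bar>) \<longlongrightarrow> x $ i - \<bar>x $ l\<bar>) (at_right 0)"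
      by (intro tendsto_intros lim)
    moreover have "0 < x $ i - \<bar>x $ l\<bar>" using x(3)[OF \<open>l \<in> I - {i}\<close>] by simp
    ultimately have "eventually (\<lambda>t. 0 < (x + t *\<^sub>R z) $ i - \<bar>(x + t *\<^sub>R z) $ l\<bar>) (at_right 0)"
      by (rule order_tendstoD(1))
    then show "eventually (\<lambda>t. \<bar>(x + t *\<^sub>R z) $ l\<bar> < (x + t *\<^sub>R z) $ i) (at_right 0)"
      by (rule eventually_mono) simp
  qed
  then have "eventually (\<lambda>t. \<forall>l\<in>I - {i}. \<bar>(x + t *\<^sub>R z) $ l\<bar> < (x + t *\<^sub>R z) $ i) (at_right 0)"
    by (intro eventually_ball_finite) auto
  moreover have "eventually (\<lambda>t. (x + t *\<^sub>R z) $ i > 0) (at_right 0)"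
    by (rule order_tendstoD(1)[OF lim x(2)])
  moreover have "eventually (\<lambda>t::real. t > 0) (at_right 0)"
    by (rule eventually_at_right_less)
  ultimately have "eventually (\<lambda>t. t > 0 \<and> (x + t *\<^sub>R z) $ i > 0 \<and>
      (\<forall>l\<in>I - {i}. \<bar>(x + t *\<^sub>R z) $ l\<bar> < (x + t *\<^sub>R z) $ i)) (at_right 0)"
    by eventually_elim auto
  from eventually_happens'[OF trivial_limit_at_right_real this]
  obtain t where t: "t > 0" "(x + t *\<^sub>R z) $ i > 0"
      "\<And>l. l \<in> I - {i} \<Longrightarrow> \<bar>(x + t *\<^sub>R z) $ l\<bar> < (x + t *\<^sub>R z) $ i" by blast
  have "x + t *\<^sub>R z \<in> V" using x(1) z V by (simp add: subspace_add subspace_scale)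
  from peak[OF this t(2,3)] peak[OF x]
  have "t * z $ j = t * (sgn (a j) * z $ i)" by (simp add: algebra_simps)
  then show ?thesis using t(1) by simp
qed

text \<open>Minimality of \<open>I\<close> means that some vector of \<open>V\<close> has a strict peak at \<open>i\<close> among the
  coordinates in \<open>I\<close>.\<close>
lemma strict_peak_of_minimal_norming:
  fixes V :: "(real ^ 'a::finite) set"
  assumes V: "subspace V" "dim V > 0" and I: "norming I V" and min: "\<not> norming (I - {i}) V"
  obtains x where "x \<in> V" "x $ i > 0" "\<And>j. j \<in> I - {i} \<Longrightarrow> \<bar>x $ j\<bar> < x $ i"
proof -
  have "\<exists>x\<in>V. x $ i \<noteq> 0 \<and> (\<forall>j\<in>I - {i}. \<bar>x $ j\<bar> < \<bar>x $ i\<bar>)"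
  proof (cases "I - {i} = {}")
    case True
    obtain x where x: "x \<in> V" "x \<noteq> 0" using nonzero_vector_of_dim_pos[OF V(2)] .
    then obtain l where "x $ l \<noteq> 0" by (auto simp: vec_eq_iff)
    moreover obtain j where "j \<in> I" "\<bar>x $ l\<bar> \<le> \<bar>x $ j\<bar>"
      using I x(1) unfolding norming_def by blast
    ultimately have "x $ i \<noteq> 0" using True by (cases "j = i") auto
    then show ?thesis using x(1) True by blast
  next
    case False
    obtain x l where x: "x \<in> V" "\<And>j. j \<in> I - {i} \<Longrightarrow> \<bar>x $ j\<bar> < \<bar>x $ l\<bar>"
      using min unfolding norming_def by (auto simp: not_le)
    obtain j where "j \<in> I" "\<bar>x $ l\<bar> \<le> \<bar>x $ j\<bar>" using I x(1) unfolding norming_def by blast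
    then have "\<bar>x $ l\<bar> \<le> \<bar>x $ i\<bar>" using x(2)[of j] by (cases "j = i") auto
    then have peak: "\<bar>x $ j\<bar> < \<bar>x $ i\<bar>" if "j \<in> I - {i}" for j using x(2)[OF that] by linarith
    moreover have "x $ i \<noteq> 0" using False peak by fastforce
    ultimately show ?thesis using x(1) by blast
  qed
  then obtain x where x: "x \<in> V" "x $ i \<noteq> 0" "\<And>j. j \<in> I - {i} \<Longrightarrow> \<bar>x $ j\<bar> < \<bar>x $ i\<bar>" by blast
  show ?thesis
  proof (rule that[of "sgn (x $ i) *\<^sub>R x"])
    show "sgn (x $ i) *\<^sub>R x \<in> V" using V(1) x(1) by (rule subspace_scale)
    have i: "(sgn (x $ i) *\<^sub>R x) $ i = \<bar>x $ i\<bar>" by (simp add: abs_sgn mult.commute)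
    show "(sgn (x $ i) *\<^sub>R x) $ i > 0" unfolding i using x(2) by simp
    show "\<bar>(sgn (x $ i) *\<^sub>R x) $ j\<bar> < (sgn (x $ i) *\<^sub>R x) $ i" if "j \<in> I - {i}" for j
      unfolding i using x(2) x(3)[OF that] by (simp add: abs_mult)
  qed
qed

text \<open>Let \<open>I\<close> be a minimal norming set. On \<open>V\<close> each coordinate in the support of row \<open>i \<in> I\<close> of
  the matrix of \<open>P\<close> is plus or minus the coordinate \<open>i\<close>, hence the supports for different \<open>i\<close>
  are disjoint. So a vector \<open>y\<close> can be chosen on each support independently, and \<open>P y\<close> takes
  arbitrary prescribed values on \<open>I\<close>. This bounds the size of \<open>I\<close> by the dimension of \<open>V\<close>.\<close>
lemma norming_of_projection:
  fixes V :: "(real ^ 'a::finite) set"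
  assumes V: "subspace V" "dim V > 0" and P: "linear P" and inV: "\<And>x. P x \<in> V"
    and fixV: "\<And>x. x \<in> V \<Longrightarrow> P x = x" and norm: "\<And>x. infnorm (P x) \<le> infnorm x"
  shows "\<exists>I. card I = dim V \<and> norming I V"
proof -
  have "norming UNIV V" by (auto simp: norming_def)
  then obtain I where I: "norming I V" and min: "\<And>J. norming J V \<Longrightarrow> card I \<le> card J"
    using ex_has_least_nat[of "\<lambda>J. norming J V" UNIV card] by blast
  define a where "a i j = P (axis j 1) $ i" for i j
  have Pa: "P x $ i = (\<Sum>j\<in>UNIV. a i j * x $ j)" for x i
    unfolding a_def by (rule linear_component_sum[OF P])
  have abs: "(\<Sum>j\<in>UNIV. \<bar>a i j\<bar>) \<le> 1" for i
    unfolding a_def by (rule abs_row_sum_le[OF P]) (simp add: norm)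
  have sum: "(\<Sum>j\<in>UNIV. a i j * x $ j) = x $ i" if "x \<in> V" for x i
    using Pa[of x i] fixV[OF that] by simp
  have "\<exists>x. x \<in> V \<and> x $ i > 0 \<and> (\<forall>j\<in>I - {i}. \<bar>x $ j\<bar> < x $ i)" if "i \<in> I" for i
  proof -
    have "card (I - {i}) < card I" using that by (intro card_Diff1_less) auto
    then have "\<not> norming (I - {i}) V" using min[of "I - {i}"] by auto
    then show ?thesis using strict_peak_of_minimal_norming[OF V I] by metis
  qed
  then obtain p where p: "\<And>i. i \<in> I \<Longrightarrow> p i \<in> V" "\<And>i. i \<in> I \<Longrightarrow> p i $ i > 0"
      "\<And>i j. i \<in> I \<Longrightarrow> j \<in> I - {i} \<Longrightarrow> \<bar>p i $ j\<bar> < p i $ i" by metis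
  have supp: "z $ j = sgn (a i j) * z $ i" if "i \<in> I" "a i j \<noteq> 0" "z \<in> V" for i j z
    using row_support_of_strict_peak[OF V(1) I sum abs p(1,2)[OF that(1)] p(3)[OF that(1)] that(2,3)] .
  have disjoint: "i = l" if i: "i \<in> I" "a i j \<noteq> 0" and l: "l \<in> I" "a l j \<noteq> 0" for i l j
  proof (rule ccontr)
    assume "i \<noteq> l"
    have "\<bar>p i $ l\<bar> = \<bar>p i $ i\<bar>"
      using arg_cong[OF supp[OF i p(1)[OF i(1)]], of abs] arg_cong[OF supp[OF l p(1)[OF i(1)]], of abs]
        i(2) l(2) by (simp add: abs_mult abs_sgn_eq)
    then show False using p(2)[of i] p(3)[of i l] i l \<open>i \<noteq> l\<close> by force
  qed
  have abs_1: "(\<Sum>j\<in>UNIV. \<bar>a i j\<bar>) = 1" if i: "i \<in> I" for i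
  proof -
    have "p i $ i = (\<Sum>j\<in>UNIV. \<bar>a i j\<bar> * p i $ i)"
      unfolding sum[OF p(1)[OF i], symmetric, of i]
    proof (rule sum.cong)
      fix j
      show "a i j * p i $ j = \<bar>a i j\<bar> * (\<Sum>j\<in>UNIV. a i j * p i $ j)"
        using supp[OF i _ p(1)[OF i], of j] unfolding sum[OF p(1)[OF i]]
        by (cases "a i j = 0") (simp_all add: abs_sgn)
    qed simp
    then show ?thesis using p(2)[OF i] by (simp add: sum_distrib_right[symmetric])
  qed
  have "{x. \<forall>i. i \<notin> I \<longrightarrow> x $ i = 0} \<subseteq> truncate I ` V"
  proof
    fix t :: "real ^ 'a" assume t: "t \<in> {x. \<forall>i. i \<notin> I \<longrightarrow> x $ i = 0}"
    define y :: "real ^ 'a" where "y = (\<chi> j. \<Sum>i\<in>I. sgn (a i j) * t $ i)"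
    have "P y $ i = t $ i" if i: "i \<in> I" for i
    proof -
      have "a i j * y $ j = \<bar>a i j\<bar> * t $ i" for j
      proof (cases "a i j = 0")
        case False
        have "(\<Sum>l\<in>I. sgn (a l j) * t $ l) = (\<Sum>l\<in>I. if l = i then sgn (a i j) * t $ i else 0)"
        proof (rule sum.cong)
          fix l assume l: "l \<in> I"
          show "sgn (a l j) * t $ l = (if l = i then sgn (a i j) * t $ i else 0)"
            using disjoint[OF i False l] by (cases "a l j = 0") auto
        qed simp
        then have "y $ j = sgn (a i j) * t $ i" using i by (simp add: y_def)
        then show ?thesis by (simp add: abs_sgn)
      qed simp
      then show ?thesis
        using abs_1[OF i] by (simp add: Pa sum_distrib_right[symmetric])
    qed
    then have "truncate I (P y) = t" using t by (auto simp: truncate_def vec_eq_iff)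
    then show "t \<in> truncate I ` V" using inV by blast
  qed
  from dim_subset[OF this] have "card I \<le> dim (truncate I ` V)"
    unfolding dim_supported .
  then have "card I \<le> dim V" using norming_dim_truncate[OF V(1) I] by simp
  then show ?thesis using I norming_dim_le_card[OF V(1) I] by (metis le_antisym)
qed

lemma norming_of_projection_constant_1:
  fixes V :: "(real ^ 'a::finite) set"
  assumes V: "subspace V" "dim V > 0" and const: "projection_constant V = 1"
  shows "\<exists>I. card I = dim V \<and> norming I V"
proof -
  obtain P where "linear P" "\<And>x. P x \<in> V" "\<And>x. x \<in> V \<Longrightarrow> P x = x"
      "\<And>x. infnorm (P x) \<le> infnorm x"
    using minimal_projection_exists[OF V(1) const] by blast
  then show ?thesis by (rule norming_of_projection[OF V])
qed

section \<open>The equivalence\<close>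

theorem theorem1:
  fixes V :: "(real ^ 'N::finite) set"
    and f :: "'m::finite \<Rightarrow> real ^ 'N"
    and F :: "real ^ 'm ^ 'N"
  assumes "CARD('N) = CARD('m) + CARD('n::finite)"
    and "subspace V"
    and "dim V + CARD('m) = CARD('N)"
    and "inj f" and "independent (range f)" and "span (range f) = V\<^sup>\<bottom>"
    and "\<And>j. column j F = f j"
  shows "((\<exists>S. card S = CARD('m) \<and> det (row_submatrix F S) \<noteq> 0 \<and>
              (\<forall>k\<in>S. (\<Sum>i\<in>UNIV. \<bar>h_vec F S k $ i\<bar>) \<le> 2))
            \<longleftrightarrow> isometrically_isomorphic V (UNIV :: (real ^ 'n) set))
       \<and> (isometrically_isomorphic V (UNIV :: (real ^ 'n) set)
            \<longleftrightarrow> banach_mazur V (UNIV :: (real ^ 'n) set) = 1)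
       \<and> (banach_mazur V (UNIV :: (real ^ 'n) set) = 1
            \<longleftrightarrow> projection_constant V = 1)"
proof -
  have dim: "dim V = CARD('n)" using assms(1,3) by simp
  then have pos: "dim V > 0" by simp
  have orth: "transpose F *v x = 0" if "x \<in> V" for x
  proof -
    have "f j \<bullet> x = 0" for j
    proof -
      have "f j \<in> V\<^sup>\<bottom>" using assms(6) span_base[of "f j" "range f"] by auto
      then show ?thesis
        using that by (auto simp: orthogonal_comp_def orthogonal_def inner_commute)
    qed
    moreover have "(transpose F *v x) $ j = f j \<bullet> x" for j
      unfolding assms(7)[symmetric]
      by (simp add: matrix_vector_mult_def transpose_def column_def inner_vec_def)
    ultimately show ?thesis by (simp add: vec_eq_iff)
  qed
  have inj: "w = 0" if w: "F *v w = 0" for w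
  proof -
    have "(\<Sum>v\<in>range f. w $ inv f v *\<^sub>R v) = (\<Sum>j\<in>UNIV. w $ j *\<^sub>R f j)"
      using assms(4) by (subst sum.reindex) (simp_all add: o_def)
    also have "\<dots> = F *v w"
      by (simp add: matrix_mult_sum assms(7) scalar_mult_eq_scaleR)
    finally have "w $ inv f (f j) = 0" for j
      using independentD[OF assms(5), of "range f" "\<lambda>v. w $ inv f v" "f j"] w by simp
    then show ?thesis using assms(4) by (simp add: vec_eq_iff)
  qed
  let ?N = "\<exists>I. card I = dim V \<and> norming I V"
  let ?h = "\<lambda>S. card S = CARD('m) \<and> det (row_submatrix F S) \<noteq> 0 \<and>
              (\<forall>k\<in>S. (\<Sum>i\<in>UNIV. \<bar>h_vec F S k $ i\<bar>) \<le> 2)"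
  have card_compl: "card (- S) = CARD('N) - card S" for S :: "'N set"
    by (simp add: Compl_eq_Diff_UNIV card_Diff_subset)
  have "(\<exists>S. ?h S) \<longleftrightarrow> ?N"
  proof
    assume "\<exists>S. ?h S"
    then obtain S where S: "?h S" by blast
    then have "S \<noteq> UNIV" using assms(1) by auto
    then have "norming (- S) V" using S orth by (intro norming_of_h_vec_bound) auto
    moreover have "card (- S) = dim V" using S dim assms(1) by (simp add: card_compl)
    ultimately show ?N by blast
  next
    assume ?N
    then obtain I where I: "norming I V" "card I = dim V" by blast
    have card: "card (- I) = CARD('m)" using I(2) assms(1,3) by (simp add: card_compl)
    have det: "det (row_submatrix F (- I)) \<noteq> 0"
      by (rule det_row_submatrix_nonzero[OF assms(2) orth inj I card])
    have "?h (- I)"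
      using card det h_vec_bound_of_norming[OF assms(2) orth I card det] by blast
    then show "\<exists>S. ?h S" by blast
  qed
  moreover have "?N \<Longrightarrow> isometrically_isomorphic V (UNIV :: (real ^ 'n) set)"
    using isometrically_isomorphic_of_norming[OF assms(2) _ _ dim] by blast
  moreover have "isometrically_isomorphic V (UNIV :: (real ^ 'n) set) \<Longrightarrow>
      banach_mazur V (UNIV :: (real ^ 'n) set) = 1"
    by (rule banach_mazur_of_isometrically_isomorphic[OF assms(2)])
  moreover have "banach_mazur V (UNIV :: (real ^ 'n) set) = 1 \<Longrightarrow> ?N"
    by (rule norming_of_banach_mazur_1[OF assms(2) dim])
  moreover have "?N \<Longrightarrow> projection_constant V = 1"
    using projection_constant_of_norming[OF assms(2) pos] by blast
  moreover have "projection_constant V = 1 \<Longrightarrow> ?N"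
    by (rule norming_of_projection_constant_1[OF assms(2) pos])
  ultimately show ?thesis by blast
qed

end
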